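(* Let $G$ be a linear algebraic group over an algebraically closed field $k$ of arbitrary characteristic, let $V,W$ be finite dimensional $G$-modules, and let $m$ be a positive integer. Take two points $y,z\in V^m\oplus W$, and assume that there is a polynomial invariant $f\in k[V^m\oplus W]^G$ such that $f(y)\neq f(z)$. Then there exists a subset $I\subseteq\{1,\ldots,m\}$ with $|I|=d\leq 1+\dim_k(V)$, and a polynomial invariant $c\in k[V^d\oplus W]^G$ with $c(\pi_I(y))\neq c(\pi_I(z))$.
   Context: A finite dimensional $G$-module is a finite dimensional $k$-vector space on which $G$ acts linearly and morphically. $V^m$ is the $m$-fold direct sum of $V$, and $V^m\oplus W$ carries the diagonal action. For a $G$-module $U$, $k[U]$ is the algebra of polynomial functions on $U$ and $k[U]^G$ the subalgebra of $G$-invariants. For $I=\{i_1,\ldots,i_d\}\subseteq\{1,\ldots,m\}$, $\pi_I:V^m\oplus W\to V^d\oplus W$ is the projection $(v_1,\ldots,v_m,w)\mapsto(v_{i_1},\ldots,v_{i_d},w)$. *)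

theory Defs
  imports
    "HOL-Computational_Algebra.Computational_Algebra"
    "HOL-Algebra.Group_Action"
    "HOL-Library.Function_Algebras"
    "HOL-Library.Product_Plus"
begin

text \<open>
  Direct sums live in function and product types, with pointwise addition. The scalar
  multiplication of a vector space is passed explicitly, as in \<^theory>\<open>HOL.Vector_Spaces\<close>.
\<close>

definition fun_scale :: "('k \<Rightarrow> 'v \<Rightarrow> 'v) \<Rightarrow> 'k \<Rightarrow> ('i \<Rightarrow> 'v) \<Rightarrow> 'i \<Rightarrow> 'v" where
  "fun_scale s c v = (\<lambda>i. s c (v i))"

definition prod_scale ::
  "('k \<Rightarrow> 'v \<Rightarrow> 'v) \<Rightarrow> ('k \<Rightarrow> 'w \<Rightarrow> 'w) \<Rightarrow> 'k \<Rightarrow> 'v \<times> 'w \<Rightarrow> 'v \<times> 'w" where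
  "prod_scale s t c = map_prod (s c) (t c)"

text \<open>
  In the following, \<open>U\<close> is a linear subspace of the ambient type, and functions on \<open>U\<close> are
  represented by functions on the whole type whose values outside \<open>U\<close> are irrelevant.
\<close>

definition linear_form_on ::
  "('k::field \<Rightarrow> 'u::ab_group_add \<Rightarrow> 'u) \<Rightarrow> 'u set \<Rightarrow> ('u \<Rightarrow> 'k) \<Rightarrow> bool" where
  "linear_form_on s U l \<longleftrightarrow>
     (\<forall>x\<in>U. \<forall>y\<in>U. l (x + y) = l x + l y) \<and> (\<forall>c. \<forall>x\<in>U. l (s c x) = c * l x)"

text \<open>The algebra \<open>k[U]\<close>, generated by the dual space of \<open>U\<close>.\<close>

inductive_set poly_functions ::
  "('k::field \<Rightarrow> 'u::ab_group_add \<Rightarrow> 'u) \<Rightarrow> 'u set \<Rightarrow> ('u \<Rightarrow> 'k) set"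
  for s :: "'k \<Rightarrow> 'u \<Rightarrow> 'u" and U :: "'u set" where
  const: "(\<lambda>_. c) \<in> poly_functions s U"
| linear_form: "linear_form_on s U l \<Longrightarrow> l \<in> poly_functions s U"
| add: "f \<in> poly_functions s U \<Longrightarrow> g \<in> poly_functions s U \<Longrightarrow>
    (\<lambda>x. f x + g x) \<in> poly_functions s U"
| mult: "f \<in> poly_functions s U \<Longrightarrow> g \<in> poly_functions s U \<Longrightarrow>
    (\<lambda>x. f x * g x) \<in> poly_functions s U"

definition zariski_closed ::
  "('k::field \<Rightarrow> 'u::ab_group_add \<Rightarrow> 'u) \<Rightarrow> 'u set \<Rightarrow> 'u set \<Rightarrow> bool" where
  "zariski_closed s U X \<longleftrightarrow> (\<exists>P \<subseteq> poly_functions s U. X = {x \<in> U. \<forall>p\<in>P. p x = 0})"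

text \<open>
  Morphisms from a closed set \<open>X \<subseteq> U\<close> to a closed set \<open>Y \<subseteq> U'\<close>: the regular functions on a closed
  set are the restrictions of polynomial functions, and a morphism pulls back regular functions
  to regular functions.
\<close>

definition variety_morphism ::
  "('k::field \<Rightarrow> 'u::ab_group_add \<Rightarrow> 'u) \<Rightarrow> 'u set \<Rightarrow> 'u set \<Rightarrow>
   ('k \<Rightarrow> 'v::ab_group_add \<Rightarrow> 'v) \<Rightarrow> 'v set \<Rightarrow> 'v set \<Rightarrow> ('u \<Rightarrow> 'v) \<Rightarrow> bool" where
  "variety_morphism s U X s' U' Y \<phi> \<longleftrightarrow>
     \<phi> ` X \<subseteq> Y \<and>
     (\<forall>p \<in> poly_functions s' U'. \<exists>q \<in> poly_functions s U. \<forall>x\<in>X. p (\<phi> x) = q x)"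

definition affine_space :: "nat \<Rightarrow> (nat \<Rightarrow> 'k::zero) set" where
  "affine_space n = {x. \<forall>i\<ge>n. x i = 0}"

text \<open>A closed subset of \<open>k\<^sup>n\<close> with a group structure whose operations are morphisms.\<close>

definition linear_algebraic_group :: "nat \<Rightarrow> (nat \<Rightarrow> 'k::alg_closed_field) monoid \<Rightarrow> bool" where
  "linear_algebraic_group n G \<longleftrightarrow>
     group G \<and>
     zariski_closed (fun_scale (*)) (affine_space n) (carrier G) \<and>
     variety_morphism
       (prod_scale (fun_scale (*)) (fun_scale (*)))
         (affine_space n \<times> affine_space n) (carrier G \<times> carrier G)
       (fun_scale (*)) (affine_space n) (carrier G)
       (\<lambda>(x, y). x \<otimes>\<^bsub>G\<^esub> y) \<and>
     variety_morphism
       (fun_scale (*)) (affine_space n) (carrier G)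
       (fun_scale (*)) (affine_space n) (carrier G)
       (\<lambda>x. inv\<^bsub>G\<^esub> x)"

text \<open>
  A finite dimensional module over a linear algebraic group in \<open>k\<^sup>n\<close>: the vector space is the whole
  type \<open>'v\<close>, and the action map \<open>G \<times> V \<rightarrow> V\<close> is a morphism.
\<close>

definition fin_dim_module ::
  "nat \<Rightarrow> (nat \<Rightarrow> 'k::alg_closed_field) monoid \<Rightarrow>
   ('k \<Rightarrow> 'v::ab_group_add \<Rightarrow> 'v) \<Rightarrow> ((nat \<Rightarrow> 'k) \<Rightarrow> 'v \<Rightarrow> 'v) \<Rightarrow> bool" where
  "fin_dim_module n G s act \<longleftrightarrow>
     (\<exists>B. finite_dimensional_vector_space s B) \<and>
     group_action G UNIV act \<and>
     (\<forall>g \<in> carrier G. Vector_Spaces.linear s s (act g)) \<and>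
     variety_morphism
       (prod_scale (fun_scale (*)) s) (affine_space n \<times> UNIV) (carrier G \<times> UNIV)
       s UNIV UNIV
       (\<lambda>(g, v). act g v)"

text \<open>
  \<open>V\<^sup>m \<oplus> W\<close>, where \<open>V\<close> and \<open>W\<close> are whole types: an \<open>m\<close>-tuple is a function that vanishes outside
  \<open>{1..m}\<close>.
\<close>

definition power_sum :: "nat \<Rightarrow> ((nat \<Rightarrow> 'v::ab_group_add) \<times> 'w::ab_group_add) set" where
  "power_sum m = {(v, w). \<forall>i. i \<notin> {1..m} \<longrightarrow> v i = 0}"

definition power_sum_scale ::
  "('k \<Rightarrow> 'v \<Rightarrow> 'v) \<Rightarrow> ('k \<Rightarrow> 'w \<Rightarrow> 'w) \<Rightarrow> 'k \<Rightarrow> (nat \<Rightarrow> 'v) \<times> 'w \<Rightarrow> (nat \<Rightarrow> 'v) \<times> 'w" where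
  "power_sum_scale s t = prod_scale (fun_scale s) t"

definition diagonal_action ::
  "('g \<Rightarrow> 'v \<Rightarrow> 'v) \<Rightarrow> ('g \<Rightarrow> 'w \<Rightarrow> 'w) \<Rightarrow> 'g \<Rightarrow> (nat \<Rightarrow> 'v) \<times> 'w \<Rightarrow> (nat \<Rightarrow> 'v) \<times> 'w" where
  "diagonal_action a b g = (\<lambda>(v, w). (\<lambda>i. a g (v i), b g w))"

definition poly_invariants ::
  "('g, 'r) monoid_scheme \<Rightarrow> ('k::field \<Rightarrow> 'u::ab_group_add \<Rightarrow> 'u) \<Rightarrow> 'u set \<Rightarrow>
   ('g \<Rightarrow> 'u \<Rightarrow> 'u) \<Rightarrow> ('u \<Rightarrow> 'k) set" where
  "poly_invariants G s U act =
     {f \<in> poly_functions s U. \<forall>g \<in> carrier G. \<forall>u\<in>U. f (act g u) = f u}"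

text \<open>\<open>\<pi>\<^sub>I\<close>, where \<open>i\<^sub>1 < \<dots> < i\<^sub>d\<close> is the increasing enumeration of \<open>I\<close>; lists are indexed from 0.\<close>

definition tuple_proj ::
  "nat set \<Rightarrow> (nat \<Rightarrow> 'v::ab_group_add) \<times> 'w \<Rightarrow> (nat \<Rightarrow> 'v) \<times> 'w" where
  "tuple_proj I =
     (\<lambda>(v, w). (\<lambda>j. if j \<in> {1..card I} then v (sorted_list_of_set I ! (j - 1)) else 0, w))"

end

theory Submission
  imports Defs
begin

text \<open>
  Invariants may be composed with equivariant linear substitutions of the \<open>V\<close>-coordinates. Take a
  minimal set \<open>I\<close> of coordinates which still separates \<open>y\<close> from \<open>z\<close>, and suppose that
  \<open>|I| \<ge> dim V + 2\<close>. Let \<open>R, R'\<close> be the spaces of linear relations among the \<open>V\<close>-coordinates, indexed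
  by \<open>I\<close>, of \<open>y\<close> and \<open>z\<close>. A substitution \<open>X\<close> may be changed by \<open>\<rho>\<close> with columns in \<open>R\<close> without changing
  its value at \<open>y\<close>, and by \<open>\<rho>'\<close> with columns in \<open>R'\<close> without changing its value at \<open>z\<close>. Moreover, by
  minimality, an invariant takes equal values at \<open>y\<close> and \<open>z\<close> after a substitution which ignores
  one of the coordinates in \<open>I\<close>. Since \<open>R \<noteq> 0\<close> and \<open>dim R' \<ge> 2\<close>, one can choose \<open>\<rho>\<close> and \<open>\<rho>'\<close> such that
  each of \<open>X + \<rho>\<close>, \<open>X + \<rho> + \<rho>'\<close>, \<open>X + \<rho>'\<close> ignores some coordinate, where \<open>X\<close> is the restriction to \<open>I\<close>.
  Passing from \<open>y\<close> to \<open>z\<close> at \<open>X + \<rho>\<close>, back to \<open>y\<close> at \<open>X + \<rho> + \<rho>'\<close>, and to \<open>z\<close> again at \<open>X + \<rho>'\<close> shows that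
  \<open>I\<close> does not separate \<open>y\<close> from \<open>z\<close>, a contradiction.
\<close>

lemma poly_functions_comp:
  assumes "f \<in> poly_functions s' U'"
    and "T ` U \<subseteq> U'"
    and "\<And>x y. x \<in> U \<Longrightarrow> y \<in> U \<Longrightarrow> T (x + y) = T x + T y"
    and "\<And>c x. x \<in> U \<Longrightarrow> T (s c x) = s' c (T x)"
  shows "(\<lambda>x. f (T x)) \<in> poly_functions s U"
  using assms(1)
proof induction
  case (linear_form l)
  then have "linear_form_on s U (\<lambda>x. l (T x))"
    using assms(2-4) by (auto simp: linear_form_on_def image_subset_iff)
  then show ?case by (rule poly_functions.linear_form)
qed (auto intro: poly_functions.intros)

text \<open>Right multiplication of the row \<open>(v 1, ..., v d)\<close> by the matrix
  \<open>A\<close>. A zero row \<open>i\<close> of \<open>A\<close> means that the input coordinate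
  \<open>v i\<close> is ignored.\<close>

definition coord_subst ::
  "('k \<Rightarrow> 'v \<Rightarrow> 'v) \<Rightarrow> nat \<Rightarrow> nat \<Rightarrow> (nat \<Rightarrow> nat \<Rightarrow> 'k) \<Rightarrow>
   (nat \<Rightarrow> 'v::ab_group_add) \<times> 'w \<Rightarrow> (nat \<Rightarrow> 'v) \<times> 'w" where
  "coord_subst s d m A =
     (\<lambda>(v, w). (\<lambda>j. if j \<in> {1..m} then \<Sum>i = 1..d. s (A i j) (v i) else 0, w))"

text \<open>The substitution is linear, and it commutes with the diagonal action because each
  \<open>actV g\<close> is linear and so passes through the sums.\<close>

lemma poly_invariants_coord_subst:
  assumes V: "vector_space sV" and W: "vector_space sW"
    and linV: "\<And>g. g \<in> carrier G \<Longrightarrow> Vector_Spaces.linear sV sV (actV g)"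
    and f: "f \<in> poly_invariants G (power_sum_scale sV sW) (power_sum m) (diagonal_action actV actW)"
  shows "(\<lambda>x. f (coord_subst sV d m A x))
    \<in> poly_invariants G (power_sum_scale sV sW) (power_sum d) (diagonal_action actV actW)"
proof -
  interpret V: vector_space sV by (rule V)
  have into: "coord_subst sV d m A ` power_sum d \<subseteq> power_sum m"
    by (auto simp: coord_subst_def power_sum_def)
  have add: "coord_subst sV d m A (x + y) = coord_subst sV d m A x + coord_subst sV d m A y" for x y
    by (auto simp: coord_subst_def plus_prod_def fun_eq_iff V.scale_right_distrib sum.distrib
        split: prod.splits)
  have scale: "coord_subst sV d m A (power_sum_scale sV sW c x)
      = power_sum_scale sV sW c (coord_subst sV d m A x)" for c x
    by (cases x) (auto simp: coord_subst_def power_sum_scale_def prod_scale_def fun_scale_def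
        fun_eq_iff V.scale_sum_right V.scale_left_commute simp del: V.scale_scale)
  have act: "coord_subst sV d m A (diagonal_action actV actW g x)
      = diagonal_action actV actW g (coord_subst sV d m A x)" if "g \<in> carrier G" for g x
  proof -
    interpret L: Vector_Spaces.linear sV sV "actV g" using linV that .
    show ?thesis
      by (cases x) (auto simp: coord_subst_def diagonal_action_def fun_eq_iff L.sum L.scale L.zero)
  qed
  from f have "f \<in> poly_functions (power_sum_scale sV sW) (power_sum m)"
    by (simp add: poly_invariants_def)
  then have "(\<lambda>x. f (coord_subst sV d m A x)) \<in> poly_functions (power_sum_scale sV sW) (power_sum d)"
    by (rule poly_functions_comp) (use into add scale in auto)
  with f act into show ?thesis
    by (auto simp: poly_invariants_def image_subset_iff)
qed

context finite_dimensional_vector_space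
begin

lemma ex_linear_relation:
  assumes "finite I" and "card I > dim (UNIV :: 'b set)"
  shows "\<exists>r a. (\<forall>i. i \<notin> I \<longrightarrow> r i = 0) \<and> a \<in> I \<and> r a = 1 \<and> (\<Sum>i\<in>I. r i *s v i) = 0"
proof (cases "inj_on v I")
  case True
  have "dependent (v ` I)"
    using independent_card_le_dim[of "v ` I" UNIV] assms(2) card_image[OF True] by auto
  then obtain u x where x: "x \<in> I" "u (v x) \<noteq> 0" and 0: "(\<Sum>x \<in> v ` I. u x *s x) = 0"
    using dependent_finite[of "v ` I"] assms(1) by auto
  let ?r = "\<lambda>i. if i \<in> I then u (v i) / u (v x) else 0"
  have "(\<Sum>i\<in>I. ?r i *s v i) = (1 / u (v x)) *s (\<Sum>i\<in>I. u (v i) *s v i)"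
    by (simp add: scale_sum_right)
  also have "\<dots> = 0"
    using 0 by (simp add: sum.reindex[OF True])
  finally show ?thesis
    using x by (intro exI[of _ ?r] exI[of _ x]) auto
next
  case False
  then obtain i j where ij: "i \<in> I" "j \<in> I" "i \<noteq> j" "v i = v j"
    by (auto simp: inj_on_def)
  let ?r = "\<lambda>l. if l = i then 1 else if l = j then - 1 else 0"
  have "(\<Sum>l\<in>I. ?r l *s v l) = (\<Sum>l\<in>{i, j}. ?r l *s v l)"
    using assms(1) ij by (intro sum.mono_neutral_right) auto
  also have "\<dots> = 0"
    using ij by simp
  finally show ?thesis
    using ij by (intro exI[of _ ?r] exI[of _ i]) auto
qed

text \<open>Gaussian elimination: without the pivot \<open>b\<close> of a first relation
  \<open>p\<close>, more than dim V vectors remain and give a relation \<open>q\<close> with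
  \<open>q b = 0\<close> and pivot \<open>c\<close>. Subtracting \<open>p c\<close> times
  \<open>q\<close> from \<open>p\<close> clears its entry at \<open>c\<close>.\<close>

lemma ex_two_linear_relations:
  assumes "finite I" and "card I > dim (UNIV :: 'b set) + 1"
  shows "\<exists>p q b c. (\<forall>i. i \<notin> I \<longrightarrow> p i = 0 \<and> q i = 0) \<and> b \<in> I \<and> c \<in> I \<and>
    p b = 1 \<and> p c = 0 \<and> q b = 0 \<and> q c = 1 \<and>
    (\<Sum>i\<in>I. p i *s v i) = 0 \<and> (\<Sum>i\<in>I. q i *s v i) = 0"
proof -
  obtain p b where p: "\<forall>i. i \<notin> I \<longrightarrow> p i = 0" "b \<in> I" "p b = 1" "(\<Sum>i\<in>I. p i *s v i) = 0"
    using ex_linear_relation[of I v] assms by auto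
  have card': "card (I - {b}) > dim (UNIV :: 'b set)"
    using assms p(2) by simp
  obtain q c where q: "\<forall>i. i \<notin> I - {b} \<longrightarrow> q i = 0" "c \<in> I - {b}" "q c = 1"
      "(\<Sum>i\<in>I - {b}. q i *s v i) = 0"
    using ex_linear_relation[of "I - {b}" v] assms(1) card' by blast
  have q0: "(\<Sum>i\<in>I. q i *s v i) = 0"
    using q assms(1) p(2) by (simp add: sum.remove[of I b])
  let ?p = "\<lambda>i. p i - p c * q i"
  have "(\<Sum>i\<in>I. ?p i *s v i) = (\<Sum>i\<in>I. p i *s v i) - p c *s (\<Sum>i\<in>I. q i *s v i)"
    by (simp add: scale_left_diff_distrib sum_subtractf scale_sum_right)
  also have "\<dots> = 0"
    using p q0 by simp
  finally show ?thesis
    using p q q0 by (intro exI[of _ ?p] exI[of _ q] exI[of _ b] exI[of _ c]) auto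
qed

end

text \<open>Unlike \<open>tuple_proj\<close>, this keeps the positions of the entries, so that the
  minimality argument stays inside one space and uses only invariants on
  \<open>power_sum m\<close>.\<close>

definition coord_restrict :: "nat set \<Rightarrow> (nat \<Rightarrow> 'v::zero) \<times> 'w \<Rightarrow> (nat \<Rightarrow> 'v) \<times> 'w" where
  "coord_restrict I = (\<lambda>(v, w). (\<lambda>i. if i \<in> I then v i else 0, w))"

lemma coord_subst_add_relation:
  assumes "vector_space s" and "\<And>j. (\<Sum>i = 1..d. s (N i j) (fst x i)) = 0"
  shows "coord_subst s d m (\<lambda>i j. A i j + N i j) x = coord_subst s d m A x"
proof -
  interpret vector_space s by fact
  show ?thesis
    using assms(2) by (auto simp: coord_subst_def fun_eq_iff scale_left_distrib sum.distrib
        split: prod.splits)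
qed

lemma coord_subst_coord_restrict:
  assumes "vector_space s" and "\<And>i j. i \<notin> I \<Longrightarrow> A i j = 0"
  shows "coord_subst s d m A (coord_restrict I x) = coord_subst s d m A x"
proof -
  interpret vector_space s by fact
  show ?thesis
    using assms(2) by (auto simp: coord_subst_def coord_restrict_def fun_eq_iff intro!: sum.cong
        split: prod.splits)
qed

lemma coord_subst_partial_identity:
  assumes "vector_space s" and "I \<subseteq> {1..m}"
  shows "coord_subst s m m (\<lambda>i j. if i = j \<and> i \<in> I then 1 else 0) x = coord_restrict I x"
proof -
  interpret vector_space s by fact
  have "(\<Sum>i = 1..m. s (if i = j \<and> i \<in> I then 1 else 0) (v i)) = (if j \<in> I then v j else 0)" for j v
  proof -
    have "(\<Sum>i = 1..m. s (if i = j \<and> i \<in> I then 1 else 0) (v i))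
        = (\<Sum>i = 1..m. if i = j then if j \<in> I then v j else 0 else 0)"
      by (intro sum.cong) auto
    then show ?thesis using assms(2) by auto
  qed
  then show ?thesis
    using assms(2) by (auto simp: coord_subst_def coord_restrict_def fun_eq_iff split: prod.splits)
qed

text \<open>The matrix puts the projected entries back into their places in \<open>I\<close>.
  Composing with it turns an invariant on \<open>power_sum m\<close> separating the restrictions
  into an invariant on \<open>power_sum (card I)\<close> separating the projections.\<close>

lemma coord_subst_tuple_proj:
  assumes "vector_space s" and "I \<subseteq> {1..m}"
  shows "coord_subst s (card I) m (\<lambda>i j. if j = sorted_list_of_set I ! (i - 1) then 1 else 0)
    (tuple_proj I x) = coord_restrict I x"
proof -
  interpret vector_space s by fact
  let ?l = "sorted_list_of_set I"
  have fin: "finite I"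
    using assms(2) by (rule finite_subset) simp
  \<comment> \<open>Tuple positions start at 1 and list indices at 0, hence the shift.\<close>
  have bij: "bij_betw (\<lambda>i. ?l ! (i - 1)) {1..card I} I"
  proof -
    have "bij_betw (\<lambda>i. i - 1) {1..card I} {..<card I}"
      by (rule bij_betw_byWitness[where f' = Suc]) auto
    moreover have "bij_betw (\<lambda>i. ?l ! i) {..<card I} I"
      using bij_betw_nth[of ?l "{..<card I}" I] fin by simp
    ultimately show ?thesis
      using bij_betw_trans by (fastforce simp: o_def)
  qed
  have "(\<Sum>i = 1..card I. s (if j = ?l ! (i - 1) then 1 else 0)
        (if i \<in> {1..card I} then v (?l ! (i - 1)) else 0)) = (if j \<in> I then v j else 0)" for j v
  proof -
    have "(\<Sum>i = 1..card I. s (if j = ?l ! (i - 1) then 1 else 0)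
          (if i \<in> {1..card I} then v (?l ! (i - 1)) else 0))
        = (\<Sum>i = 1..card I. (\<lambda>l. if j = l then v l else 0) (?l ! (i - 1)))"
      by (intro sum.cong) auto
    also have "\<dots> = (\<Sum>l\<in>I. if j = l then v l else 0)"
      by (rule sum.reindex_bij_betw[OF bij])
    finally show ?thesis using fin by simp
  qed
  then show ?thesis
    using assms(2)
    by (auto simp: coord_subst_def coord_restrict_def tuple_proj_def fun_eq_iff split: prod.splits)
qed

text \<open>Invariance enters only through closure under substitutions, so an arbitrary
  \<open>S\<close> with this closure replaces the set of invariants.\<close>

lemma coord_restrict_eq_if_minimal:
  fixes sV :: "'k::field \<Rightarrow> 'v::ab_group_add \<Rightarrow> 'v" and y z :: "(nat \<Rightarrow> 'v) \<times> 'w::ab_group_add"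
  assumes V: "finite_dimensional_vector_space sV B"
    and I: "I \<subseteq> {1..m}" and card: "card I > vector_space.dim sV (UNIV :: 'v set) + 1"
    and closed: "\<And>f A. f \<in> S \<Longrightarrow> (\<lambda>x. f (coord_subst sV m m A x)) \<in> S"
    and min: "\<And>f a. f \<in> S \<Longrightarrow> a \<in> I \<Longrightarrow>
      f (coord_restrict (I - {a}) y) = f (coord_restrict (I - {a}) z)"
    and f: "f \<in> S"
  shows "f (coord_restrict I y) = f (coord_restrict I z)"
proof -
  interpret V: finite_dimensional_vector_space sV B by (rule V)
  note vs = V.vector_space_axioms
  have fin: "finite I"
    using I by (rule finite_subset) simp
  obtain r a where r: "\<forall>i. i \<notin> I \<longrightarrow> r i = 0" "a \<in> I" "r a = 1"
      "(\<Sum>i\<in>I. sV (r i) (fst y i)) = 0"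
    using V.ex_linear_relation[OF fin, of "fst y"] card by auto
  obtain p q b c where pq: "\<forall>i. i \<notin> I \<longrightarrow> p i = 0 \<and> q i = 0" "b \<in> I" "c \<in> I"
      "p b = 1" "p c = 0" "q b = 0" "q c = 1"
      "(\<Sum>i\<in>I. sV (p i) (fst z i)) = 0" "(\<Sum>i\<in>I. sV (q i) (fst z i)) = 0"
    using V.ex_two_linear_relations[OF fin card, of "fst z"] by blast
  have extend: "(\<Sum>i = 1..m. sV (u i) (v i)) = (\<Sum>i\<in>I. sV (u i) (v i))"
    if "\<forall>i. i \<notin> I \<longrightarrow> u i = 0" for u :: "nat \<Rightarrow> 'k" and v
    using that I by (intro sum.mono_neutral_right) auto
  have r0: "(\<Sum>i = 1..m. sV (r i) (fst y i)) = 0"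
    and p0: "(\<Sum>i = 1..m. sV (p i) (fst z i)) = 0"
    and q0: "(\<Sum>i = 1..m. sV (q i) (fst z i)) = 0"
    using r pq extend by auto
  define X :: "nat \<Rightarrow> nat \<Rightarrow> 'k" where "X = (\<lambda>i j. if i = j \<and> i \<in> I then 1 else 0)"
  \<comment> \<open>As \<open>r a = 1\<close>, row \<open>a\<close> of \<open>X + R\<close>
    vanishes.\<close>
  define R where "R = (\<lambda>i j. - X a j * r i)"
  \<comment> \<open>The pivots of \<open>p\<close> and \<open>q\<close> make row \<open>b\<close> of
    \<open>X + R + R'\<close> and row \<open>c\<close> of \<open>X + R'\<close> vanish at
    once.\<close>
  define R' where "R' = (\<lambda>i j. - (X b j + R b j) * p i - X c j * q i)"
  have R: "(\<Sum>i = 1..m. sV (R i j) (fst y i)) = 0" for j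
  proof -
    have "(\<Sum>i = 1..m. sV (R i j) (fst y i)) = sV (- X a j) (\<Sum>i = 1..m. sV (r i) (fst y i))"
      unfolding R_def V.scale_sum_right by simp
    then show ?thesis using r0 by simp
  qed
  have R': "(\<Sum>i = 1..m. sV (R' i j) (fst z i)) = 0" for j
  proof -
    have "(\<Sum>i = 1..m. sV (R' i j) (fst z i))
        = sV (- (X b j + R b j)) (\<Sum>i = 1..m. sV (p i) (fst z i))
          - sV (X c j) (\<Sum>i = 1..m. sV (q i) (fst z i))"
      unfolding R'_def V.scale_sum_right V.scale_left_diff_distrib sum_subtractf by simp
    then show ?thesis using p0 q0 by simp
  qed
  have supp: "X i j = 0 \<and> R i j = 0 \<and> R' i j = 0" if "i \<notin> I" for i j
    using that r pq by (auto simp: X_def R_def R'_def)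
  let ?T = "coord_subst sV m m"
  \<comment> \<open>Such a substitution factors through the restriction to \<open>I - {e}\<close>,
    where minimality applies to \<open>f\<close> composed with it.\<close>
  have switch: "f (?T A y) = f (?T A z)"
    if "e \<in> I" "\<And>j. A e j = 0" "\<And>i j. i \<notin> I \<Longrightarrow> A i j = 0" for e A
  proof -
    have "?T A (coord_restrict (I - {e}) u) = ?T A u" for u :: "(nat \<Rightarrow> 'v) \<times> 'w"
      using vs by (rule coord_subst_coord_restrict) (use that(2,3) in auto)
    with min[OF closed[OF f, of A] that(1)] show ?thesis
      by simp
  qed
  have "f (coord_restrict I y) = f (?T X y)"
    by (simp add: X_def coord_subst_partial_identity[OF vs I])
  also have "\<dots> = f (?T (\<lambda>i j. X i j + R i j) y)"
    by (simp add: coord_subst_add_relation[OF vs R])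
  also have "\<dots> = f (?T (\<lambda>i j. X i j + R i j) z)"
    by (rule switch[of a]) (use r supp in \<open>auto simp: R_def\<close>)
  also have "\<dots> = f (?T (\<lambda>i j. (X i j + R i j) + R' i j) z)"
    by (simp add: coord_subst_add_relation[OF vs R'])
  also have "\<dots> = f (?T (\<lambda>i j. (X i j + R i j) + R' i j) y)"
    by (rule switch[of b, symmetric]) (use pq supp in \<open>auto simp: R'_def\<close>)
  also have "\<dots> = f (?T (\<lambda>i j. (X i j + R' i j) + R i j) y)"
    by (simp add: ac_simps)
  also have "\<dots> = f (?T (\<lambda>i j. X i j + R' i j) y)"
    by (simp add: coord_subst_add_relation[OF vs R])
  also have "\<dots> = f (?T (\<lambda>i j. X i j + R' i j) z)"
    by (rule switch[of c]) (use pq supp in \<open>auto simp: R'_def\<close>)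
  also have "\<dots> = f (?T X z)"
    by (simp add: coord_subst_add_relation[OF vs R'])
  also have "\<dots> = f (coord_restrict I z)"
    by (simp add: X_def coord_subst_partial_identity[OF vs I])
  finally show ?thesis .
qed

theorem theorem6p1:
  fixes G :: "(nat \<Rightarrow> 'k::alg_closed_field) monoid"
    and sV :: "'k \<Rightarrow> 'v::ab_group_add \<Rightarrow> 'v" and actV :: "(nat \<Rightarrow> 'k) \<Rightarrow> 'v \<Rightarrow> 'v"
    and sW :: "'k \<Rightarrow> 'w::ab_group_add \<Rightarrow> 'w" and actW :: "(nat \<Rightarrow> 'k) \<Rightarrow> 'w \<Rightarrow> 'w"
    and n m :: nat
    and y z :: "(nat \<Rightarrow> 'v) \<times> 'w"
  assumes "linear_algebraic_group n G"
    and "fin_dim_module n G sV actV"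
    and "fin_dim_module n G sW actW"
    and "m > 0"
    and "y \<in> power_sum m" and "z \<in> power_sum m"
    and "\<exists>f \<in> poly_invariants G (power_sum_scale sV sW) (power_sum m)
                (diagonal_action actV actW). f y \<noteq> f z"
  shows "\<exists>I d. I \<subseteq> {1..m} \<and> card I = d \<and> d \<le> 1 + vector_space.dim sV (UNIV :: 'v set) \<and>
           (\<exists>c \<in> poly_invariants G (power_sum_scale sV sW) (power_sum d)
                   (diagonal_action actV actW).
              c (tuple_proj I y) \<noteq> c (tuple_proj I z))"
proof -
  let ?Inv = "\<lambda>d. poly_invariants G (power_sum_scale sV sW) (power_sum d) (diagonal_action actV actW)"
  obtain B C where V: "finite_dimensional_vector_space sV B"
    and W: "finite_dimensional_vector_space sW C"
    and lin: "\<And>g. g \<in> carrier G \<Longrightarrow> Vector_Spaces.linear sV sV (actV g)"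
    using assms(2,3) by (auto simp: fin_dim_module_def)
  note vs = finite_dimensional_vector_space.axioms(1)[OF V] finite_dimensional_vector_space.axioms(1)[OF W]
  have subst: "(\<lambda>x. h (coord_subst sV d m A x)) \<in> ?Inv d" if "h \<in> ?Inv m" for h d A
    using vs lin that by (rule poly_invariants_coord_subst)
  define sep where "sep I \<longleftrightarrow> I \<subseteq> {1..m} \<and>
    (\<exists>f \<in> ?Inv m. f (coord_restrict I y) \<noteq> f (coord_restrict I z))" for I
  have "coord_restrict {1..m} u = u" if "u \<in> power_sum m" for u :: "(nat \<Rightarrow> 'v) \<times> 'w"
    using that by (auto simp: coord_restrict_def power_sum_def fun_eq_iff)
  then have "sep {1..m}"
    using assms(5-7) by (simp add: sep_def)
  \<comment> \<open>Least cardinality suffices, since \<open>I\<close> is compared only with the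
    smaller sets \<open>I - {a}\<close>.\<close>
  then obtain I where I: "sep I" and least: "\<And>J. sep J \<Longrightarrow> card I \<le> card J"
    using ex_has_least_nat[of sep "{1..m}" card] by blast
  from I obtain f where sub: "I \<subseteq> {1..m}" and f: "f \<in> ?Inv m"
    and neq: "f (coord_restrict I y) \<noteq> f (coord_restrict I z)"
    by (auto simp: sep_def)
  have "finite I"
    using sub by (rule finite_subset) simp
  have "card I \<le> 1 + vector_space.dim sV (UNIV :: 'v set)"
  proof (rule ccontr)
    assume "\<not> ?thesis"
    then have card: "card I > vector_space.dim sV (UNIV :: 'v set) + 1"
      by simp
    have min: "h (coord_restrict (I - {a}) y) = h (coord_restrict (I - {a}) z)"
      if "h \<in> ?Inv m" "a \<in> I" for h a
    proof -
      have "card (I - {a}) < card I"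
        using \<open>finite I\<close> that(2) by (rule card_Diff1_less)
      with least[of "I - {a}"] that sub show ?thesis
        by (auto simp: sep_def)
    qed
    have "f (coord_restrict I y) = f (coord_restrict I z)"
      by (rule coord_restrict_eq_if_minimal[where S = "?Inv m"]) (fact V sub card subst min f)+
    with neq show False ..
  qed
  moreover define c where "c = (\<lambda>x. f (coord_subst sV (card I) m
    (\<lambda>i j. if j = sorted_list_of_set I ! (i - 1) then 1 else 0) x))"
  have "c \<in> ?Inv (card I)"
    unfolding c_def using f by (rule subst)
  moreover have "c (tuple_proj I u) = f (coord_restrict I u)" for u
    unfolding c_def coord_subst_tuple_proj[OF vs(1) sub] ..
  with neq have "c (tuple_proj I y) \<noteq> c (tuple_proj I z)"
    by simp
  ultimately show ?thesis
    using sub by (intro exI[of _ I] exI[of _ "card I"] conjI bexI[of _ c] refl)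
qed

end
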